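(* Let $H=(\sigma,\alpha)$ be a connected orientable hypermap, and let $E'\subseteq E(H)$. Then the partial dual $H^{E'}$ with respect to $E'$ can be written in the two-permutation $(\sigma,\alpha)$ model as $H^{E'}=(\sigma^{E'},\alpha^{E'})$, where \[ \sigma^{E'}=\alpha_{E'}^{-1}\sigma,\qquad \alpha^{E'}=\alpha_{E'}^{-1}\alpha_{\overline{E'}}. \] Equivalently, $\alpha^{E'}$ is obtained from $\alpha$ by reversing all cycles corresponding to hyperedges in $E'$ and leaving the remaining cycles unchanged.
   Context: Permutations are composed from right to left. A connected orientable hypermap in the two-permutation model is a pair $H=(\sigma,\alpha)$ of permutations of a finite set $D=\{1,\dots,n\}$ of darts such that the group generated by $\sigma,\alpha$ acts transitively on $D$. Vertices are the cycles of $\sigma$, hyperedges are the cycles of $\alpha$ (fixed points count as cycles), and faces are the cycles of $\phi=\alpha^{-1}\sigma$; $E(H)$ is the set of hyperedges. For $E'\subseteq E(H)$, $\overline{E'}=E(H)\setminus E'$, and $\alpha_{E'}$, $\alpha_{\overline{E'}}$ denote the products of the $\alpha$-cycles in $E'$ and in $\overline{E'}$ respectively, so that they commute and $\alpha=\alpha_{E'}\alpha_{\overline{E'}}$. In the three-permutation model an orientable hypermap is a triple $(\delta_V,\delta_E,\delta_F)$ of permutations of $D$ with $\delta_F\delta_E\delta_V=1$, whose cycles record vertices, hyperedges and faces. The two models are translated into each other by $\delta_V=\sigma$, $\delta_E=\alpha^{-1}$, $\delta_F=\phi^{-1}=\sigma^{-1}\alpha$. For a set $E'$ of hyperedges (cycles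 of $\delta_E$, which correspond to cycles of $\alpha$), let $\delta_{E'}$ and $\delta_{\overline{E'}}$ be the products of the cycles of $\delta_E$ corresponding to $E'$ and to $\overline{E'}$. The partial dual $H^{E'}$ is (by the formula of Chmutov and Vignes-Tourneret) the hypermap given in the three-permutation model by \[ \bigl(\delta_{E'}\delta_V,\ \delta_{\overline{E'}}\delta_{E'}^{-1},\ \delta_F\delta_{E'}\bigr). \] *)

theory Defs
  imports "HOL-Algebra.Sym_Groups" "HOL-Combinatorics.Orbits"
begin

text \<open>The dart set is \<open>{1..n}\<close>; permutations of it are functions \<open>p :: nat \<Rightarrow> nat\<close> with
  \<open>p permutes {1..n}\<close>, composed from right to left by \<open>\<circ>\<close>. We write \<open>inv'\<close> for the inverse
  function, since \<open>HOL-Algebra\<close> uses the symbol \<open>inv\<close> for inverses in a group record.\<close>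

text \<open>A cycle is represented by its set of darts, so that distinct fixed points give distinct
  cycles. The cyclic order on \<open>c \<in> cycles n p\<close> is that of \<open>p\<close>: as a permutation, the cycle is
  \<open>perm_restrict p c\<close>, which agrees with \<open>p\<close> on \<open>c\<close> and fixes everything else.\<close>

definition cycles :: "nat \<Rightarrow> (nat \<Rightarrow> nat) \<Rightarrow> nat set set" where
  "cycles n p = orbit p ` {1..n}"

text \<open>The product of a set of cycles of \<open>p\<close>. The factors have disjoint supports and hence commute,
  so the fold does not depend on the order of the factors.\<close>

definition cycle_product :: "(nat \<Rightarrow> nat) \<Rightarrow> nat set set \<Rightarrow> nat \<Rightarrow> nat" where
  "cycle_product p C = Finite_Set.fold (\<lambda>c q. perm_restrict p c \<circ> q) id C"

definition connected_hypermap :: "nat \<Rightarrow> (nat \<Rightarrow> nat) \<times> (nat \<Rightarrow> nat) \<Rightarrow> bool" where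
  "connected_hypermap n = (\<lambda>(\<sigma>, \<alpha>).
     \<sigma> permutes {1..n} \<and> \<alpha> permutes {1..n} \<and>
     (\<forall>x\<in>{1..n}. \<forall>y\<in>{1..n}. \<exists>g\<in>generate (sym_group n) {\<sigma>, \<alpha>}. g x = y))"

definition hyperedges :: "nat \<Rightarrow> (nat \<Rightarrow> nat) \<times> (nat \<Rightarrow> nat) \<Rightarrow> nat set set" where
  "hyperedges n = (\<lambda>(\<sigma>, \<alpha>). cycles n \<alpha>)"

definition face_perm :: "(nat \<Rightarrow> nat) \<times> (nat \<Rightarrow> nat) \<Rightarrow> nat \<Rightarrow> nat" where
  "face_perm = (\<lambda>(\<sigma>, \<alpha>). inv' \<alpha> \<circ> \<sigma>)"

text \<open>Translation from the two-permutation to the three-permutation model,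
  \<open>(\<delta>\<^sub>V, \<delta>\<^sub>E, \<delta>\<^sub>F) = (\<sigma>, \<alpha>\<^sup>-\<^sup>1, \<phi>\<^sup>-\<^sup>1)\<close>. It is injective on pairs of permutations,
  so a triple stands for at most one hypermap in the two-permutation model.\<close>

definition three_model ::
    "(nat \<Rightarrow> nat) \<times> (nat \<Rightarrow> nat) \<Rightarrow> (nat \<Rightarrow> nat) \<times> (nat \<Rightarrow> nat) \<times> (nat \<Rightarrow> nat)" where
  "three_model = (\<lambda>(\<sigma>, \<alpha>). (\<sigma>, inv' \<alpha>, inv' (face_perm (\<sigma>, \<alpha>))))"

text \<open>The formula of Chmutov and Vignes-Tourneret. The set \<open>E'\<close> consists of cycles of \<open>\<delta>\<^sub>E\<close>; for
  \<open>\<delta>\<^sub>E = \<alpha>\<^sup>-\<^sup>1\<close> these are, as sets of darts, the same as the cycles of \<open>\<alpha>\<close>, see \<open>cycles_inv\<close> below.\<close>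

definition partial_dual ::
    "nat \<Rightarrow> (nat \<Rightarrow> nat) \<times> (nat \<Rightarrow> nat) \<times> (nat \<Rightarrow> nat) \<Rightarrow> nat set set \<Rightarrow>
     (nat \<Rightarrow> nat) \<times> (nat \<Rightarrow> nat) \<times> (nat \<Rightarrow> nat)" where
  "partial_dual n = (\<lambda>(\<delta>V, \<delta>E, \<delta>F) E'.
     (cycle_product \<delta>E E' \<circ> \<delta>V,
      cycle_product \<delta>E (cycles n \<delta>E - E') \<circ> inv' (cycle_product \<delta>E E'),
      \<delta>F \<circ> cycle_product \<delta>E E'))"

text \<open>\<open>\<beta>\<close> is the permutation obtained from \<open>\<alpha>\<close> by reversing the cycles in \<open>E'\<close> and leaving
  the remaining cycles unchanged.\<close>

definition reverses_cycles ::
    "nat \<Rightarrow> (nat \<Rightarrow> nat) \<Rightarrow> nat set set \<Rightarrow> (nat \<Rightarrow> nat) \<Rightarrow> bool" where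
  "reverses_cycles n \<alpha> E' \<beta> \<longleftrightarrow>
     \<beta> permutes {1..n} \<and> cycles n \<beta> = cycles n \<alpha> \<and>
     (\<forall>c\<in>E'. perm_restrict \<beta> c = inv' (perm_restrict \<alpha> c)) \<and>
     (\<forall>c\<in>cycles n \<alpha> - E'. perm_restrict \<beta> c = perm_restrict \<alpha> c)"

lemma permutation_darts: "p permutes {1..n::nat} \<Longrightarrow> permutation p"
  by (auto simp: permutation_permutes)

lemma cycles_inv:
  assumes "p permutes {1..n}"
  shows "cycles n (inv' p) = cycles n p"
  using orbit_inv_eq[OF permutation_darts[OF assms]] by (simp add: cycles_def)

lemma orbit_eq_cycle:
  assumes "p permutes {1..n}" "c \<in> cycles n p" "x \<in> c"
  shows "orbit p x = c"
  using assms orbit_cyclic_eq3[OF cyclic_on_orbit'[OF permutation_darts[OF assms(1)]]]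
  by (auto simp: cycles_def)

lemma cycles_disjoint:
  assumes "p permutes {1..n}" "c \<in> cycles n p" "d \<in> cycles n p" "c \<noteq> d"
  shows "c \<inter> d = {}"
  using assms orbit_eq_cycle by blast

lemma cycles_closed:
  assumes "p permutes {1..n}" "c \<in> cycles n p"
  shows "p x \<in> c \<longleftrightarrow> x \<in> c"
proof -
  note perm = permutation_darts[OF assms(1)]
  have "orbit p (p x) = orbit p x" by (rule permutation_orbit_step[OF perm])
  then show ?thesis
    using orbit_eq_cycle[OF assms] permutation_self_in_orbit[OF perm] by blast
qed

lemma cycle_product_eq:
  assumes "p permutes {1..n}" "C \<subseteq> cycles n p"
  shows "cycle_product p C = perm_restrict p (\<Union>C)"
proof -
  have comm: "perm_restrict p c \<circ> perm_restrict p d = perm_restrict p d \<circ> perm_restrict p c"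
    if "c \<in> cycles n p" "d \<in> cycles n p" for c d
    using cycles_disjoint[OF assms(1) that] cycles_closed[OF assms(1) that(1)]
      cycles_closed[OF assms(1) that(2)]
    by (cases "c = d") (auto simp: fun_eq_iff perm_restrict_def)
  interpret comp_fun_commute_on "cycles n p" "\<lambda>c q. perm_restrict p c \<circ> q"
    by standard (auto simp: fun_eq_iff dest: comm[THEN fun_cong])
  have "finite C" using assms(2) by (rule finite_subset) (simp add: cycles_def)
  then show ?thesis using assms(2)
  proof induction
    case empty
    then show ?case by (simp add: cycle_product_def fun_eq_iff perm_restrict_def)
  next
    case (insert c C)
    have "cycle_product p (insert c C) = perm_restrict p c \<circ> perm_restrict p (\<Union>C)"
      using insert by (simp add: cycle_product_def)
    also have "\<dots> = perm_restrict p (\<Union>(insert c C))"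
    proof (rule ext)
      fix x
      have cl: "p x \<in> d \<longleftrightarrow> x \<in> d" if "d \<in> insert c C" for d
        using cycles_closed[OF assms(1)] that insert.prems by blast
      have dj: "c \<inter> d = {}" if "d \<in> C" for d
        using cycles_disjoint[OF assms(1), of c d] that insert by blast
      show "(perm_restrict p c \<circ> perm_restrict p (\<Union>C)) x = perm_restrict p (\<Union>(insert c C)) x"
        using cl dj by (auto simp: perm_restrict_def)
    qed
    finally show ?case .
  qed
qed

lemma Union_cycles:
  assumes "p permutes {1..n}"
  shows "\<Union>(cycles n p) = {1..n}"
  using permutes_orbit_subset[OF assms] permutation_self_in_orbit[OF permutation_darts[OF assms]]
  by (fastforce simp: cycles_def)

lemma cycle_product_split:
  assumes "p permutes {1..n}" "C \<subseteq> cycles n p"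
  shows "cycle_product p C \<circ> cycle_product p (cycles n p - C) = p"
    and "cycle_product p (cycles n p - C) \<circ> cycle_product p C = p"
proof -
  have U: "x \<in> \<Union>C \<or> x \<in> \<Union>(cycles n p - C) \<or> p x = x" for x
    using Union_cycles[OF assms(1)] permutes_not_in[OF assms(1), of x] by blast
  have dj: "\<not> (x \<in> \<Union>C \<and> x \<in> \<Union>(cycles n p - C))" for x
    using cycles_disjoint[OF assms(1)] assms(2) by blast
  have cl: "p x \<in> \<Union>C \<longleftrightarrow> x \<in> \<Union>C"
    "p x \<in> \<Union>(cycles n p - C) \<longleftrightarrow> x \<in> \<Union>(cycles n p - C)" for x
    using cycles_closed[OF assms(1)] assms(2) by blast+
  note eq = cycle_product_eq[OF assms] cycle_product_eq[OF assms(1) Diff_subset]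
  have "(cycle_product p C \<circ> cycle_product p (cycles n p - C)) x = p x" for x
    unfolding eq comp_apply perm_restrict_def using U[of x] dj[of x] cl[of x] by (auto simp del: Union_iff)
  moreover have "(cycle_product p (cycles n p - C) \<circ> cycle_product p C) x = p x" for x
    unfolding eq comp_apply perm_restrict_def using U[of x] dj[of x] cl[of x] by (auto simp del: Union_iff)
  ultimately show "cycle_product p C \<circ> cycle_product p (cycles n p - C) = p"
    "cycle_product p (cycles n p - C) \<circ> cycle_product p C = p" by blast+
qed

lemma three_model_relation:
  assumes "\<sigma> permutes {1..n}" "\<alpha> permutes {1..n}" "three_model (\<sigma>, \<alpha>) = (\<delta>V, \<delta>E, \<delta>F)"
  shows "\<delta>F = inv' \<sigma> \<circ> \<alpha>" "\<delta>F \<circ> \<delta>E \<circ> \<delta>V = id"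
proof -
  have b: "bij \<sigma>" "bij \<alpha>" using assms permutes_bij by blast+
  show F: "\<delta>F = inv' \<sigma> \<circ> \<alpha>"
    using assms(3) b by (auto simp: three_model_def face_perm_def o_inv_distrib bij_imp_bij_inv inv_inv_eq)
  have "\<delta>V = \<sigma>" "\<delta>E = inv' \<alpha>" using assms(3) by (simp_all add: three_model_def)
  then show "\<delta>F \<circ> \<delta>E \<circ> \<delta>V = id"
    using b unfolding F by (simp add: fun_eq_iff bij_is_inj bij_is_surj surj_f_inv_f)
qed

end

theory Submission
  imports Defs
begin

text \<open>
  Write \<open>\<alpha>\<^sub>E\<close> and \<open>\<alpha>\<^sub>C\<close> for the products of the \<open>\<alpha>\<close>-cycles in \<open>E'\<close> and in its complement, and
  \<open>U\<close> for the set of darts on the hyperedges in \<open>E'\<close>. Since \<open>U\<close> is a union of cycles of \<open>\<alpha>\<close>,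
  restricting \<open>\<alpha>\<close> to \<open>U\<close> commutes with inversion (\<open>inv_perm_restrict_invariant\<close>), so the product
  of the cycles of \<open>\<delta>\<^sub>E = \<alpha>\<^sup>-\<^sup>1\<close> in \<open>E'\<close> is \<open>\<alpha>\<^sub>E\<^sup>-\<^sup>1\<close>, and likewise for the complement
  (\<open>cycle_product_inv\<close>). After this substitution, the formula of Chmutov and Vignes-Tourneret
  reduces to cancellations between permutations; the face component, for instance, is
  \<open>\<sigma>\<^sup>-\<^sup>1 \<alpha> \<alpha>\<^sub>E\<^sup>-\<^sup>1 = \<sigma>\<^sup>-\<^sup>1 \<alpha>\<^sub>C = (\<alpha>\<^sub>E\<^sup>-\<^sup>1 \<sigma>)\<^sup>-\<^sup>1 (\<alpha>\<^sub>E\<^sup>-\<^sup>1 \<alpha>\<^sub>C)\<close>.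

  The permutation \<open>\<alpha>\<^sub>E\<^sup>-\<^sup>1 \<alpha>\<^sub>C\<close> is \<open>\<alpha>\<^sup>-\<^sup>1\<close> on \<open>U\<close> and \<open>\<alpha>\<close> off \<open>U\<close> (\<open>partial_inverse_apply\<close>),
  which is what reversing the cycles in \<open>E'\<close> means. A permutation is determined by its
  restrictions to the parts of a partition of the darts, so no other permutation qualifies.

  Connectedness of the dual does not come from an equality of groups: in general \<open>\<alpha>\<^sub>E\<close> is not in
  the group generated by \<open>\<alpha>\<^sub>E\<^sup>-\<^sup>1 \<sigma>\<close> and \<open>\<alpha>\<^sub>E\<^sup>-\<^sup>1 \<alpha>\<^sub>C\<close>. The two groups nevertheless have the same
  invariant sets of darts, and transitivity depends only on these
  (\<open>connected_hypermap_iff_no_invariant_subset\<close>). A set closed under \<open>\<alpha>\<^sub>E\<^sup>-\<^sup>1 \<alpha>\<^sub>C\<close> is a union of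
  cycles of that permutation, which are the cycles of \<open>\<alpha>\<close>, and hence is closed under \<open>\<alpha>\<close> and
  \<open>\<alpha>\<^sub>E\<close>; if it is also closed under \<open>\<alpha>\<^sub>E\<^sup>-\<^sup>1 \<sigma>\<close>, then it is closed under
  \<open>\<sigma> = \<alpha>\<^sub>E (\<alpha>\<^sub>E\<^sup>-\<^sup>1 \<sigma>)\<close>.
\<close>

section \<open>Restricting a permutation to an invariant set\<close>

lemma perm_restrict_invariant_inverse:
  assumes "bij p" "\<And>x. p x \<in> U \<longleftrightarrow> x \<in> U"
  shows "perm_restrict p U \<circ> perm_restrict (inv' p) U = id"
    and "perm_restrict (inv' p) U \<circ> perm_restrict p U = id"
proof -
  have r: "p (inv' p x) = x" and l: "inv' p (p x) = x" for x
    using assms(1) by (simp_all add: bij_is_surj bij_is_inj surj_f_inv_f)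
  have "inv' p x \<in> U \<longleftrightarrow> x \<in> U" for x
    using assms(2)[of "inv' p x"] r by simp
  then show "perm_restrict p U \<circ> perm_restrict (inv' p) U = id"
    "perm_restrict (inv' p) U \<circ> perm_restrict p U = id"
    using assms(2) r l by (auto simp: fun_eq_iff perm_restrict_def)
qed

lemma inv_perm_restrict_invariant:
  assumes "bij p" "\<And>x. p x \<in> U \<longleftrightarrow> x \<in> U"
  shows "inv' (perm_restrict p U) = perm_restrict (inv' p) U"
  using perm_restrict_invariant_inverse[OF assms] by (rule inv_unique_comp)

lemma perm_restrict_invariant_permutes:
  assumes "p permutes S" "\<And>x. p x \<in> U \<longleftrightarrow> x \<in> U"
  shows "perm_restrict p U permutes S"
proof -
  have "bij (perm_restrict p U)"
    using perm_restrict_invariant_inverse[OF permutes_bij[OF assms(1)] assms(2)] o_bij by blast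
  then show ?thesis
    using assms(1) by (auto simp: bij_iff permutes_def perm_restrict_def)
qed

section \<open>Products of cycles\<close>

lemma Union_cycles_invariant:
  assumes "p permutes {1..n}" "C \<subseteq> cycles n p"
  shows "p x \<in> \<Union>C \<longleftrightarrow> x \<in> \<Union>C"
  using cycles_closed[OF assms(1)] assms(2) by blast

lemma cycle_product_permutes:
  assumes "p permutes {1..n}" "C \<subseteq> cycles n p"
  shows "cycle_product p C permutes {1..n}"
  unfolding cycle_product_eq[OF assms]
  using assms(1) Union_cycles_invariant[OF assms] by (rule perm_restrict_invariant_permutes)

lemma inv_cycle_product_eq:
  assumes "p permutes {1..n}" "C \<subseteq> cycles n p"
  shows "inv' (cycle_product p C) = perm_restrict (inv' p) (\<Union>C)"
  unfolding cycle_product_eq[OF assms]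
  using permutes_bij[OF assms(1)] Union_cycles_invariant[OF assms]
  by (rule inv_perm_restrict_invariant)

lemma cycle_product_inv:
  assumes "p permutes {1..n}" "C \<subseteq> cycles n p"
  shows "cycle_product (inv' p) C = inv' (cycle_product p C)"
proof -
  have "C \<subseteq> cycles n (inv' p)" using assms(2) cycles_inv[OF assms(1)] by simp
  from cycle_product_eq[OF permutes_inv[OF assms(1)] this]
  show ?thesis by (simp add: inv_cycle_product_eq[OF assms])
qed

section \<open>Reversing a set of cycles\<close>

lemma partial_inverse_apply:
  assumes "p permutes {1..n}" "C \<subseteq> cycles n p"
  shows "(inv' (cycle_product p C) \<circ> cycle_product p (cycles n p - C)) x =
         (if x \<in> \<Union>C then inv' p x else p x)"
proof -
  have off: "perm_restrict p (\<Union>(cycles n p - C)) x = (if x \<in> \<Union>C then x else p x)"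
  proof -
    have "\<not> (x \<in> \<Union>C \<and> x \<in> \<Union>(cycles n p - C))"
      using cycles_disjoint[OF assms(1)] assms(2) by blast
    moreover have "x \<in> \<Union>C \<or> x \<in> \<Union>(cycles n p - C) \<or> p x = x"
      using Union_cycles[OF assms(1)] permutes_not_in[OF assms(1), of x] by blast
    ultimately show ?thesis by (auto simp: perm_restrict_def simp del: Union_iff)
  qed
  show ?thesis
    unfolding inv_cycle_product_eq[OF assms] comp_apply cycle_product_eq[OF assms(1) Diff_subset] off
    using Union_cycles_invariant[OF assms, of x] by (auto simp: perm_restrict_def simp del: Union_iff)
qed

lemma partial_inverse_permutes:
  assumes "p permutes {1..n}" "C \<subseteq> cycles n p"
  shows "inv' (cycle_product p C) \<circ> cycle_product p (cycles n p - C) permutes {1..n}"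
  using cycle_product_permutes[OF assms] cycle_product_permutes[OF assms(1) Diff_subset]
  by (intro permutes_compose permutes_inv)

text \<open>On each cycle of \<open>p\<close> the partial inverse agrees with \<open>p\<close> or with \<open>p\<^sup>-\<^sup>1\<close>, and these have
  the same orbits.\<close>

lemma cycles_partial_inverse:
  assumes "p permutes {1..n}" "C \<subseteq> cycles n p"
  shows "cycles n (inv' (cycle_product p C) \<circ> cycle_product p (cycles n p - C)) = cycles n p"
proof -
  define q where "q = inv' (cycle_product p C) \<circ> cycle_product p (cycles n p - C)"
  have q: "q x = (if x \<in> \<Union>C then inv' p x else p x)" for x
    unfolding q_def by (rule partial_inverse_apply[OF assms])
  note perm = permutation_darts[OF assms(1)]
  have "orbit q x = orbit p x" if x: "x \<in> {1..n}" for x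
  proof -
    have c: "orbit p x \<in> cycles n p" using x by (auto simp: cycles_def)
    have self: "x \<in> orbit p x" by (rule permutation_self_in_orbit[OF perm])
    show ?thesis
    proof (cases "orbit p x \<in> C")
      case True
      have "orbit q x = orbit (inv' p) x"
      proof (rule orbit_cong)
        show "x \<in> orbit (inv' p) x" using self orbit_inv_eq[OF perm] by simp
        show "q s = inv' p s" if "s \<in> orbit (inv' p) x" for s
          using that True orbit_inv_eq[OF perm] q by auto
      qed
      then show ?thesis using orbit_inv_eq[OF perm] by simp
    next
      case False
      show ?thesis
      proof (rule orbit_cong)
        show "x \<in> orbit p x" by (rule self)
        show "q s = p s" if "s \<in> orbit p x" for s
        proof -
          have "s \<notin> \<Union>C"
            using that False c assms(2) cycles_disjoint[OF assms(1), of "orbit p x"] by blast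
          then show ?thesis by (simp add: q del: Union_iff)
        qed
      qed
    qed
  qed
  then show ?thesis unfolding q_def[symmetric] by (simp add: cycles_def)
qed

lemma reverses_cycles_partial_inverse:
  assumes "p permutes {1..n}" "C \<subseteq> cycles n p"
  shows "reverses_cycles n p C (inv' (cycle_product p C) \<circ> cycle_product p (cycles n p - C))"
proof -
  define q where "q = inv' (cycle_product p C) \<circ> cycle_product p (cycles n p - C)"
  have q: "q x = (if x \<in> \<Union>C then inv' p x else p x)" for x
    unfolding q_def by (rule partial_inverse_apply[OF assms])
  have "perm_restrict q c = inv' (perm_restrict p c)" if "c \<in> C" for c
  proof -
    have "p x \<in> c \<longleftrightarrow> x \<in> c" for x using cycles_closed[OF assms(1)] that assms(2) by blast
    then have "inv' (perm_restrict p c) = perm_restrict (inv' p) c"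
      by (rule inv_perm_restrict_invariant[OF permutes_bij[OF assms(1)]])
    then show ?thesis using that q by (auto simp: fun_eq_iff perm_restrict_def)
  qed
  moreover have "perm_restrict q c = perm_restrict p c" if "c \<in> cycles n p - C" for c
  proof -
    have "x \<notin> \<Union>C" if "x \<in> c" for x
      using that \<open>c \<in> cycles n p - C\<close> assms(2) cycles_disjoint[OF assms(1), of c] by blast
    then show ?thesis by (simp add: fun_eq_iff perm_restrict_def q del: Union_iff)
  qed
  ultimately show ?thesis
    using partial_inverse_permutes[OF assms] cycles_partial_inverse[OF assms]
    by (simp add: reverses_cycles_def q_def)
qed

text \<open>The cycles of \<open>p\<close> cover the darts, and on each cycle both permutations have the same
  prescribed restriction.\<close>

lemma reverses_cycles_unique:
  assumes p: "p permutes {1..n}"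
    and "reverses_cycles n p C q" "reverses_cycles n p C r"
  shows "q = r"
proof (rule ext)
  fix x
  show "q x = r x"
  proof (cases "x \<in> {1..n}")
    case True
    then obtain c where c: "c \<in> cycles n p" "x \<in> c" using Union_cycles[OF p] by blast
    have "perm_restrict q c = perm_restrict r c"
      using assms(2,3) c(1) by (cases "c \<in> C") (auto simp: reverses_cycles_def)
    then show ?thesis using c(2) by (metis perm_restrict_simps(1))
  next
    case False
    then show ?thesis
      using assms(2,3) permutes_not_in[OF _ False] unfolding reverses_cycles_def by metis
  qed
qed

section \<open>Connectedness by invariant sets\<close>

lemma permutes_inv_mem_closed:
  assumes "p permutes S" "finite S" "T \<subseteq> S" "p ` T \<subseteq> T" "x \<in> T"
  shows "inv' p x \<in> T"
proof -
  have "p ` T = T"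
    using assms by (meson endo_inj_surj finite_subset permutes_inj_on)
  then obtain y where "y \<in> T" "x = p y" using assms(5) by blast
  then show ?thesis using permutes_inverses(2)[OF assms(1)] by simp
qed

text \<open>Transitivity in this form can be transferred between groups that have the same invariant
  sets but different elements. One direction takes for the invariant set the orbit of a dart; in
  the other, closure of a set under the generators extends to the inverses of the generators since
  the set is finite.\<close>

lemma connected_hypermap_iff_no_invariant_subset:
  "connected_hypermap n (\<sigma>, \<alpha>) \<longleftrightarrow>
     \<sigma> permutes {1..n} \<and> \<alpha> permutes {1..n} \<and>
     (\<forall>T \<subseteq> {1..n}. T \<noteq> {} \<longrightarrow> \<sigma> ` T \<subseteq> T \<longrightarrow> \<alpha> ` T \<subseteq> T \<longrightarrow> T = {1..n})"
  (is "_ \<longleftrightarrow> ?S \<and> ?A \<and> ?inv")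
proof -
  let ?G = "generate (sym_group n) {\<sigma>, \<alpha>}"
  have "(\<forall>x\<in>{1..n}. \<forall>y\<in>{1..n}. \<exists>g\<in>?G. g x = y) \<longleftrightarrow> ?inv" if perms: ?S ?A
  proof
    assume trans: "\<forall>x\<in>{1..n}. \<forall>y\<in>{1..n}. \<exists>g\<in>?G. g x = y"
    show ?inv
    proof (intro allI impI)
      fix T assume T: "T \<subseteq> {1..n}" "T \<noteq> {}" "\<sigma> ` T \<subseteq> T" "\<alpha> ` T \<subseteq> T"
      have closed: "g x \<in> T" if "g \<in> ?G" "x \<in> T" for g x
        using that
      proof (induction arbitrary: x)
        case one
        then show ?case by (simp add: sym_group_one)
      next
        case (incl h)
        then show ?case using T(3,4) by blast
      next
        case (inv h)
        have h: "h permutes {1..n}" "h ` T \<subseteq> T" using inv.hyps perms T(3,4) by auto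
        then have "inv\<^bsub>sym_group n\<^esub> h = inv' h"
          by (simp add: sym_group_carrier)
        then show ?case
          using permutes_inv_mem_closed[OF h(1) _ T(1) h(2) inv.prems] by simp
      next
        case (eng g h)
        then show ?case by (simp add: sym_group_mult)
      qed
      obtain x where "x \<in> T" using T(2) by blast
      have "y \<in> T" if y: "y \<in> {1..n}" for y
      proof -
        have "x \<in> {1..n}" using \<open>x \<in> T\<close> T(1) by (rule subsetD[rotated])
        then obtain g where "g \<in> ?G" "g x = y" using trans y by meson
        then show ?thesis using closed[OF _ \<open>x \<in> T\<close>] by metis
      qed
      then show "T = {1..n}" by (intro subset_antisym T(1) subsetI)
    qed
  next
    assume min: ?inv
    have sub: "g permutes {1..n}" if "g \<in> ?G" for g
      using group.generate_in_carrier[OF sym_group_is_group _ that] perms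
      by (auto simp: sym_group_carrier)
    show "\<forall>x\<in>{1..n}. \<forall>y\<in>{1..n}. \<exists>g\<in>?G. g x = y"
    proof
      fix x assume x: "x \<in> {1..n}"
      define T where "T = (\<lambda>g. g x) ` ?G"
      have TI: "g x \<in> T" if "g \<in> ?G" for g
        using that unfolding T_def by (rule imageI)
      have sub_T: "T \<subseteq> {1..n}"
      proof
        fix y assume "y \<in> T"
        then obtain g where "g \<in> ?G" "y = g x" unfolding T_def by (rule imageE)
        then show "y \<in> {1..n}" using permutes_in_image[OF sub] x by metis
      qed
      have nonempty: "T \<noteq> {}" using TI[OF generate.one] by (metis empty_iff)
      have closed: "h ` T \<subseteq> T" if h: "h \<in> {\<sigma>, \<alpha>}" for h
      proof (rule image_subsetI)
        fix y assume "y \<in> T"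
        then obtain g where g: "g \<in> ?G" "y = g x" unfolding T_def by (rule imageE)
        have "h \<circ> g \<in> ?G"
          using generate.eng[OF generate.incl[OF h] g(1)] by (simp add: sym_group_mult)
        from TI[OF this] show "h y \<in> T" using g(2) by simp
      qed
      have "T = {1..n}"
        using min[rule_format, OF sub_T nonempty closed closed] by simp
      show "\<forall>y\<in>{1..n}. \<exists>g\<in>?G. g x = y"
      proof
        fix y assume "y \<in> {1..n}"
        then have "y \<in> T" unfolding \<open>T = {1..n}\<close> .
        then obtain g where "g \<in> ?G" "y = g x" unfolding T_def by (rule imageE)
        then show "\<exists>g\<in>?G. g x = y" by (intro bexI[of _ g]) simp_all
      qed
    qed
  qed
  then show ?thesis by (auto simp: connected_hypermap_def)
qed

lemma connected_hypermap_partial_dual: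
  assumes H: "connected_hypermap n (\<sigma>, \<alpha>)" and E: "E' \<subseteq> cycles n \<alpha>"
  shows "connected_hypermap n
    (inv' (cycle_product \<alpha> E') \<circ> \<sigma>,
     inv' (cycle_product \<alpha> E') \<circ> cycle_product \<alpha> (cycles n \<alpha> - E'))"
    (is "connected_hypermap n (?\<sigma>', ?\<alpha>')")
proof -
  have \<sigma>: "\<sigma> permutes {1..n}" and \<alpha>: "\<alpha> permutes {1..n}"
    using H by (auto simp: connected_hypermap_def)
  note A = cycle_product_permutes[OF \<alpha> E]
  have \<sigma>': "?\<sigma>' permutes {1..n}" using \<sigma> A by (intro permutes_compose permutes_inv)
  have \<alpha>': "?\<alpha>' permutes {1..n}" by (rule partial_inverse_permutes[OF \<alpha> E])
  have "T = {1..n}"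
    if T: "T \<subseteq> {1..n}" "T \<noteq> {}" "?\<sigma>' ` T \<subseteq> T" "?\<alpha>' ` T \<subseteq> T" for T
  proof -
    have \<alpha>T: "\<alpha> x \<in> T" if x: "x \<in> T" for x
    proof (cases "x \<in> \<Union>E'")
      case True
      \<comment> \<open>On a reversed hyperedge \<open>\<alpha>\<close> is the inverse of the new hyperedge permutation.\<close>
      have "?\<alpha>' (\<alpha> x) = x"
        unfolding partial_inverse_apply[OF \<alpha> E]
        using True Union_cycles_invariant[OF \<alpha> E, of x] permutes_inverses(2)[OF \<alpha>]
        by (simp del: Union_iff)
      then have "inv' ?\<alpha>' x = \<alpha> x" using permutes_inv_eq[OF \<alpha>'] by simp
      then show ?thesis
        using permutes_inv_mem_closed[OF \<alpha>' _ T(1,4) x] by simp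
    next
      case False
      then have "?\<alpha>' x = \<alpha> x"
        unfolding partial_inverse_apply[OF \<alpha> E] by (simp del: Union_iff)
      then show ?thesis using T(4) x by force
    qed
    have "\<sigma> x \<in> T" if x: "x \<in> T" for x
    proof -
      have "cycle_product \<alpha> E' (?\<sigma>' x) = \<sigma> x" using permutes_inverses(1)[OF A] by simp
      moreover have "?\<sigma>' x \<in> T" using T(3) x by blast
      then have "cycle_product \<alpha> E' (?\<sigma>' x) \<in> T"
        using \<alpha>T unfolding cycle_product_eq[OF \<alpha> E] perm_restrict_def by presburger
      ultimately show ?thesis by simp
    qed
    then have "\<sigma> ` T \<subseteq> T" "\<alpha> ` T \<subseteq> T" using \<alpha>T by (simp_all add: image_subset_iff)
    then show ?thesis
      using H T(1,2) unfolding connected_hypermap_iff_no_invariant_subset by simp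
  qed
  then show ?thesis
    using \<sigma>' \<alpha>' unfolding connected_hypermap_iff_no_invariant_subset by (intro conjI allI impI)
qed

section \<open>The partial dual in the two-permutation model\<close>

lemma three_model_partial_dual:
  assumes \<sigma>: "\<sigma> permutes {1..n}" and \<alpha>: "\<alpha> permutes {1..n}" and E: "E' \<subseteq> cycles n \<alpha>"
  shows "three_model (inv' (cycle_product \<alpha> E') \<circ> \<sigma>,
           inv' (cycle_product \<alpha> E') \<circ> cycle_product \<alpha> (cycles n \<alpha> - E')) =
         partial_dual n (three_model (\<sigma>, \<alpha>)) E'"
proof -
  let ?A = "cycle_product \<alpha> E'" and ?B = "cycle_product \<alpha> (cycles n \<alpha> - E')"
  have A: "?A permutes {1..n}" by (rule cycle_product_permutes[OF \<alpha> E])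
  have B: "?B permutes {1..n}" by (rule cycle_product_permutes[OF \<alpha> Diff_subset])
  have \<sigma>': "inv' ?A \<circ> \<sigma> permutes {1..n}" using \<sigma> A by (intro permutes_compose permutes_inv)
  have \<alpha>': "inv' ?A \<circ> ?B permutes {1..n}" using A B by (intro permutes_compose permutes_inv)
  note bijs = permutes_bij[OF \<sigma>] permutes_bij[OF A] permutes_bij[OF B]
  have E_inv: "cycle_product (inv' \<alpha>) E' = inv' ?A"
    "cycle_product (inv' \<alpha>) (cycles n (inv' \<alpha>) - E') = inv' ?B"
    using cycle_product_inv[OF \<alpha> E] cycle_product_inv[OF \<alpha> Diff_subset]
    by (simp_all add: cycles_inv[OF \<alpha>])
  have hyperedge: "inv' (inv' ?A \<circ> ?B) = inv' ?B \<circ> ?A"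
    using bijs by (simp add: o_inv_distrib bij_imp_bij_inv inv_inv_eq)
  have face: "inv' (inv' ?A \<circ> \<sigma>) \<circ> (inv' ?A \<circ> ?B) = inv' \<sigma> \<circ> \<alpha> \<circ> inv' ?A"
  proof -
    have "\<alpha> \<circ> inv' ?A = ?B \<circ> ?A \<circ> inv' ?A" using cycle_product_split(2)[OF \<alpha> E] by simp
    also have "\<dots> = ?B" using permutes_inv_o(1)[OF A] by (simp add: comp_assoc)
    finally have \<alpha>A: "\<alpha> \<circ> inv' ?A = ?B" .
    have "inv' (inv' ?A \<circ> \<sigma>) = inv' \<sigma> \<circ> ?A"
      using bijs by (simp add: o_inv_distrib bij_imp_bij_inv inv_inv_eq)
    then show ?thesis
      using permutes_inverses(1)[OF A] \<alpha>A by (simp add: fun_eq_iff)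
  qed
  have "inv' (face_perm (inv' ?A \<circ> \<sigma>, inv' ?A \<circ> ?B)) = inv' \<sigma> \<circ> \<alpha> \<circ> inv' ?A"
    using three_model_relation(1)[OF \<sigma>' \<alpha>'] face by (simp add: three_model_def)
  moreover have "inv' (face_perm (\<sigma>, \<alpha>)) = inv' \<sigma> \<circ> \<alpha>"
    using three_model_relation(1)[OF \<sigma> \<alpha>] by (simp add: three_model_def)
  ultimately show ?thesis
    using E_inv hyperedge bijs by (simp add: three_model_def partial_dual_def inv_inv_eq)
qed

theorem proposition2p4:
  fixes n :: nat and \<sigma> \<alpha> :: "nat \<Rightarrow> nat" and E' :: "nat set set"
  assumes "connected_hypermap n (\<sigma>, \<alpha>)"
    and "E' \<subseteq> hyperedges n (\<sigma>, \<alpha>)"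
  shows "let \<alpha>E = cycle_product \<alpha> E';
             \<alpha>C = cycle_product \<alpha> (hyperedges n (\<sigma>, \<alpha>) - E');
             \<sigma>' = inv' \<alpha>E \<circ> \<sigma>;
             \<alpha>' = inv' \<alpha>E \<circ> \<alpha>C
         in connected_hypermap n (\<sigma>', \<alpha>') \<and>
            three_model (\<sigma>', \<alpha>') = partial_dual n (three_model (\<sigma>, \<alpha>)) E' \<and>
            (\<forall>\<beta>. \<beta> = \<alpha>' \<longleftrightarrow> reverses_cycles n \<alpha> E' \<beta>)"
proof -
  have \<sigma>: "\<sigma> permutes {1..n}" and \<alpha>: "\<alpha> permutes {1..n}"
    using assms(1) by (auto simp: connected_hypermap_def)
  have edges: "hyperedges n (\<sigma>, \<alpha>) = cycles n \<alpha>" by (simp add: hyperedges_def)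
  have E: "E' \<subseteq> cycles n \<alpha>" using assms(2) edges by simp
  show ?thesis
    unfolding Let_def edges
    using connected_hypermap_partial_dual[OF assms(1) E] three_model_partial_dual[OF \<sigma> \<alpha> E]
      reverses_cycles_partial_inverse[OF \<alpha> E] reverses_cycles_unique[OF \<alpha>]
    by blast
qed

end
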